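(* Let $n\ge2$ be a natural number, let a group $G$ act on a nonempty set $\Omega$, and suppose $\Omega$ is $(n,r)$-paradoxical with respect to this action. Then $r\ge 2n$.
   Context: For $\gamma\in G$ and $E\subseteq\Omega$ write $\gamma(E)=\{\gamma\cdot x:x\in E\}$. For $E,F\subseteq\Omega$ and $r\in\mathbb N$, write $E\sim_r F$ if there are a partition $E=E_0\sqcup\dots\sqcup E_{r-1}$ and elements $\gamma_0,\dots,\gamma_{r-1}\in G$ with $F=\gamma_0(E_0)\sqcup\dots\sqcup\gamma_{r-1}(E_{r-1})$ (a disjoint union). A set $E\subseteq\Omega$ is $(n,r)$-paradoxical with respect to the action if there is a partition $E=P_0\sqcup\dots\sqcup P_{n-1}$ and natural numbers $r_0,\dots,r_{n-1}$ with $P_j\sim_{r_j}E$ for all $j<n$ and $r_0+\dots+r_{n-1}=r$. *)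

theory Defs
  imports "HOL-Algebra.Group_Action" "HOL-Library.Disjoint_Sets"
begin

text \<open>A partition into \<open>r\<close> pieces is an indexed family; pieces may be empty and \<open>r = 0\<close> is
  allowed. Points outside \<open>\<Omega>\<close> carry no action, so all sets are required to lie in \<open>\<Omega>\<close>.\<close>

definition indexed_partition :: "nat \<Rightarrow> (nat \<Rightarrow> 'x set) \<Rightarrow> 'x set \<Rightarrow> bool" where
  "indexed_partition r A E \<longleftrightarrow> disjoint_family_on A {..<r} \<and> (\<Union>i<r. A i) = E"

definition equidecomposable ::
    "('g, 'm) monoid_scheme \<Rightarrow> 'x set \<Rightarrow> ('g \<Rightarrow> 'x \<Rightarrow> 'x) \<Rightarrow> nat \<Rightarrow> 'x set \<Rightarrow> 'x set \<Rightarrow> bool" where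
  "equidecomposable G \<Omega> \<phi> r E F \<longleftrightarrow>
     E \<subseteq> \<Omega> \<and> F \<subseteq> \<Omega> \<and>
     (\<exists>A \<gamma>. indexed_partition r A E \<and>
            (\<forall>i<r. \<gamma> i \<in> carrier G) \<and>
            indexed_partition r (\<lambda>i. \<phi> (\<gamma> i) ` A i) F)"

definition paradoxical ::
    "('g, 'm) monoid_scheme \<Rightarrow> 'x set \<Rightarrow> ('g \<Rightarrow> 'x \<Rightarrow> 'x) \<Rightarrow> nat \<Rightarrow> nat \<Rightarrow> 'x set \<Rightarrow> bool" where
  "paradoxical G \<Omega> \<phi> n r E \<longleftrightarrow>
     E \<subseteq> \<Omega> \<and>
     (\<exists>P s. indexed_partition n P E \<and>
            (\<forall>j<n. equidecomposable G \<Omega> \<phi> (s j) (P j) E) \<and>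
            (\<Sum>j<n. s j) = r)"

end

theory Submission
  imports Defs
begin

text \<open>Each piece \<open>P j\<close> has to be reassembled into all of \<open>\<Omega>\<close>.
  With no translates only the empty set arises, and a single translate yields
  \<open>\<Omega>\<close> only from \<open>\<Omega>\<close> itself, since group elements act
  bijectively (\<open>equidecomposable_whole_ge_2\<close>). No piece is empty
  (\<open>equidecomposable_empty_left\<close>), so for \<open>n \<ge> 2\<close> every piece is
  proper and needs \<open>s j \<ge> 2\<close>; summing over the \<open>n\<close> pieces gives the
  bound.\<close>

lemma equidecomposable_empty_left:
  "equidecomposable G \<Omega> \<phi> r {} F \<Longrightarrow> F = {}"
  by (auto simp: equidecomposable_def indexed_partition_def)

text \<open>A group element permutes the whole space \<open>E\<close>, so one translate of a proper
  subset is again proper.\<close>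

lemma (in group_action) equidecomposable_whole_ge_2:
  assumes eq: "equidecomposable G E \<phi> r P E" and "P \<noteq> E" and "E \<noteq> {}"
  shows "r \<ge> 2"
proof (rule ccontr)
  assume "\<not> r \<ge> 2"
  from eq obtain A \<gamma> where "P \<subseteq> E" and P: "(\<Union>i<r. A i) = P"
    and \<gamma>: "\<forall>i<r. \<gamma> i \<in> carrier G" and E: "(\<Union>i<r. \<phi> (\<gamma> i) ` A i) = E"
    by (auto simp: equidecomposable_def indexed_partition_def)
  from E \<open>E \<noteq> {}\<close> have "r \<noteq> 0" by auto
  with \<open>\<not> r \<ge> 2\<close> have r: "r = 1" by simp
  with \<gamma> have \<gamma>0: "\<gamma> 0 \<in> carrier G" by simp
  from r P E have "\<phi> (\<gamma> 0) ` P = E" by (simp add: lessThan_Suc)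
  \<comment> \<open>\<open>P\<close> and \<open>E\<close> get the same image, so injectivity on
    \<open>E\<close> identifies them.\<close>
  also have "\<dots> = \<phi> (\<gamma> 0) ` E" using surj_prop[OF \<gamma>0] by simp
  finally have "P = E"
    using inj_on_image_eq_iff[OF inj_prop[OF \<gamma>0] \<open>P \<subseteq> E\<close>] by simp
  with \<open>P \<noteq> E\<close> show False ..
qed

theorem theorem3p4:
  fixes G :: "('g, 'm) monoid_scheme"
    and \<Omega> :: "'x set"
    and \<phi> :: "'g \<Rightarrow> 'x \<Rightarrow> 'x"
    and n r :: nat
  assumes "n \<ge> 2"
    and "group_action G \<Omega> \<phi>"
    and "\<Omega> \<noteq> {}"
    and "paradoxical G \<Omega> \<phi> n r \<Omega>"
  shows "r \<ge> 2 * n"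
proof -
  from assms(4) obtain P s where disj: "disjoint_family_on P {..<n}"
    and un: "(\<Union>j<n. P j) = \<Omega>"
    and eq: "\<forall>j<n. equidecomposable G \<Omega> \<phi> (s j) (P j) \<Omega>"
    and r: "(\<Sum>j<n. s j) = r"
    by (auto simp: paradoxical_def indexed_partition_def)
  \<comment> \<open>\<open>indexed_partition\<close> admits empty pieces; here they are excluded
    because each must produce \<open>\<Omega> \<noteq> {}\<close>.\<close>
  have nonempty: "P j \<noteq> {}" if "j < n" for j
    using eq that \<open>\<Omega> \<noteq> {}\<close> equidecomposable_empty_left by metis
  have "s j \<ge> 2" if "j < n" for j
  proof -
    \<comment> \<open>A second index exists as \<open>n \<ge> 2\<close>; the points of
      \<open>P k\<close> are missing from \<open>P j\<close>, which makes \<open>P j\<close>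
      proper.\<close>
    obtain k where k: "k < n" "k \<noteq> j"
      using \<open>n \<ge> 2\<close> that by (cases "j = 0") (auto intro: that[of 1] that[of 0])
    have "P j \<inter> P k = {}"
      using disjoint_family_onD[OF disj] k \<open>j < n\<close> by auto
    moreover have "P k \<subseteq> \<Omega>" using un k by auto
    ultimately have "P j \<noteq> \<Omega>" using nonempty[OF k(1)] by auto
    then show ?thesis
      using group_action.equidecomposable_whole_ge_2[OF assms(2)] eq \<open>j < n\<close> \<open>\<Omega> \<noteq> {}\<close> by blast
  qed
  then have "(\<Sum>j<n. 2) \<le> (\<Sum>j<n. s j)" by (intro sum_mono) simp
  with r show ?thesis by simp
qed

end
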